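(* Let $C_i\subseteq\mathcal H$ be closed and convex, $i\in I:=\{1,\ldots,m\}$, such that $C:=\bigcap_{i\in I}C_i\ne\emptyset$. For each $k=0,1,2,\ldots$, let $U_k\colon\mathcal H\to\mathcal H$ be $\rho_k$-strongly quasi-nonexpansive with $C\subseteq F:=\bigcap_{k=0}^\infty\operatorname{Fix}U_k$, and let $\rho:=\inf_k\rho_k>0$. Let $x^k$ be generated by $x^{k+1}:=U_kx^k$, $k=0,1,2,\ldots$, where $x^0\in\mathcal H$ is arbitrary. In addition, let $\{n_k^i\}_{k=0}^\infty$, $i\in I$, be increasing sequences of nonnegative integers with bounded growth, that is, $0<n_{k+1}^i-n_k^i\le s$ for all $k=0,1,2,\ldots$ and $i\in I$, for some $s>0$. (i) If for each $i\in I$ the subsequence $\{U_{n_k^i}\}_{k=0}^\infty$ is weakly $C_i$-regular, then $\{x^k\}_{k=0}^\infty$ converges weakly to some $x^*\in C$. (ii) If for each $i\in I$ the subsequence $\{U_{n_k^i}\}_{k=0}^\infty$ is boundedly $C_i$-regular and the family $\{C_i\mid i\in I\}$ is boundedly regular, then $\{x^k\}_{k=0}^\infty$ converges in norm to some $x^*\in C$. (iii) If for each $i\in I$ the subsequence $\{U_{n_k^i}\}_{k=0}^\infty$ is boundedly linearly $C_i$-regular and the family $\{C_i\mid i\in I\}$ is boundedly linearly regular, then $\{x^k\}_{k=0}^\infty$ converges $R$-linearly to some $x^*\in C$, that is, $\|x^k-x^*\|\le 2d(x^0,C)q^k$, $k=0,1,2,\ldots$, for some $q\in(0,1)$.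
   Context: $\mathcal H$ is a real Hilbert space, $\operatorname{Fix}U:=\{x\in\mathcal H\mid Ux=x\}$, and $d(x,C):=\inf_{y\in C}\|x-y\|$. For $\rho\ge 0$, an operator $T\colon\mathcal H\to\mathcal H$ is $\rho$-strongly quasi-nonexpansive if $\operatorname{Fix}T\ne\emptyset$ and $\|Tu-z\|^2\le\|u-z\|^2-\rho\|Tu-u\|^2$ for all $u\in\mathcal H$, $z\in\operatorname{Fix}T$; it is quasi-nonexpansive if this holds with $\rho=0$. Let $D\subseteq\mathcal H$ be nonempty, closed and convex. A sequence $\{V_k\}_{k=0}^\infty$ of quasi-nonexpansive operators $V_k\colon\mathcal H\to\mathcal H$ is: (a) weakly $D$-regular if for every sequence $\{x^k\}_{k=0}^\infty\subseteq\mathcal H$ and every strictly increasing sequence $\{n_k\}$ of nonnegative integers, $x^{n_k}\rightharpoonup y$ (weakly, as $k\to\infty$) and $\|V_kx^k-x^k\|\to 0$ imply $y\in D$; (b) boundedly $D$-regular if for every bounded sequence $\{x^k\}_{k=0}^\infty\subseteq\mathcal H$, $\|V_kx^k-x^k\|\to 0$ implies $d(x^k,D)\to 0$; (c) boundedly linearly $D$-regular if for every nonempty bounded $S\subseteq\mathcal H$ there is $\delta>0$ (depending on $S$) such that $d(x,D)\le\delta\|V_kx-x\|$ for all $x\in S$ and all $k=0,1,2,\ldots$. These are applied to the sequence $V_k:=U_{n_k^i}$, $k=0,1,2,\ldots$. A family of closed convex sets $C_i$, $i\in I=\{1,\ldots,m\}$, with $C=\bigcap_{i\in I}C_i\neq\emptyset$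 is boundedly regular if for every bounded sequence $\{x^k\}_{k=0}^\infty\subseteq\mathcal H$, $\max_{i\in I}d(x^k,C_i)\to 0$ implies $d(x^k,C)\to 0$; it is boundedly linearly regular if for every nonempty bounded $S\subseteq\mathcal H$ there is $\kappa>0$ such that $d(x,C)\le\kappa\max_{i\in I}d(x,C_i)$ for all $x\in S$. *)

theory Defs
  imports "HOL-Analysis.Analysis"
begin

(* A real Hilbert space is a type of sort {real_inner, complete_space}.
   The distance d(x, D) of a point to a nonempty set is infdist x D. *)

definition Fix :: "('a \<Rightarrow> 'a) \<Rightarrow> 'a set" where
  "Fix T = {x. T x = x}"

definition strongly_quasi_nonexpansive :: "real \<Rightarrow> ('a::real_inner \<Rightarrow> 'a) \<Rightarrow> bool" where
  "strongly_quasi_nonexpansive \<rho> T \<longleftrightarrow>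
     0 \<le> \<rho> \<and> Fix T \<noteq> {} \<and>
     (\<forall>u. \<forall>z\<in>Fix T. (norm (T u - z))\<^sup>2 \<le> (norm (u - z))\<^sup>2 - \<rho> * (norm (T u - u))\<^sup>2)"

definition weakly_converges_to :: "(nat \<Rightarrow> 'a::real_inner) \<Rightarrow> 'a \<Rightarrow> bool" where
  "weakly_converges_to x y \<longleftrightarrow> (\<forall>h. (\<lambda>k. x k \<bullet> h) \<longlonglongrightarrow> y \<bullet> h)"

(* In the three regularity notions for operators, V is understood to be a sequence of
   quasi-nonexpansive operators and D to be nonempty, closed and convex. These conditions are
   not part of the predicates. The same holds, in the two notions for families of sets, for the
   C i being closed and convex with a common point, and for I being finite and nonempty. *)

definition weakly_regular :: "'a::real_inner set \<Rightarrow> (nat \<Rightarrow> 'a \<Rightarrow> 'a) \<Rightarrow> bool" where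
  "weakly_regular D V \<longleftrightarrow>
     (\<forall>x n y. strict_mono (n :: nat \<Rightarrow> nat) \<longrightarrow>
        weakly_converges_to (\<lambda>k. x (n k)) y \<longrightarrow>
        (\<lambda>k. norm (V k (x k) - x k)) \<longlonglongrightarrow> 0 \<longrightarrow> y \<in> D)"

definition boundedly_regular :: "'a::real_inner set \<Rightarrow> (nat \<Rightarrow> 'a \<Rightarrow> 'a) \<Rightarrow> bool" where
  "boundedly_regular D V \<longleftrightarrow>
     (\<forall>x. bounded (range x) \<longrightarrow>
        (\<lambda>k. norm (V k (x k) - x k)) \<longlonglongrightarrow> 0 \<longrightarrow>
        (\<lambda>k. infdist (x k) D) \<longlonglongrightarrow> 0)"

definition boundedly_linearly_regular :: "'a::real_inner set \<Rightarrow> (nat \<Rightarrow> 'a \<Rightarrow> 'a) \<Rightarrow> bool" where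
  "boundedly_linearly_regular D V \<longleftrightarrow>
     (\<forall>S. S \<noteq> {} \<longrightarrow> bounded S \<longrightarrow>
        (\<exists>\<delta>>0. \<forall>x\<in>S. \<forall>k. infdist x D \<le> \<delta> * norm (V k x - x)))"

definition boundedly_regular_family :: "'i set \<Rightarrow> ('i \<Rightarrow> 'a::real_inner set) \<Rightarrow> bool" where
  "boundedly_regular_family I C \<longleftrightarrow>
     (\<forall>x :: nat \<Rightarrow> 'a. bounded (range x) \<longrightarrow>
        (\<lambda>k. MAX i\<in>I. infdist (x k) (C i)) \<longlonglongrightarrow> 0 \<longrightarrow>
        (\<lambda>k. infdist (x k) (\<Inter>i\<in>I. C i)) \<longlonglongrightarrow> 0)"

definition boundedly_linearly_regular_family :: "'i set \<Rightarrow> ('i \<Rightarrow> 'a::real_inner set) \<Rightarrow> bool" where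
  "boundedly_linearly_regular_family I C \<longleftrightarrow>
     (\<forall>S. S \<noteq> {} \<longrightarrow> bounded S \<longrightarrow>
        (\<exists>\<kappa>>0. \<forall>x\<in>S. infdist x (\<Inter>i\<in>I. C i) \<le> \<kappa> * (MAX i\<in>I. infdist x (C i))))"

end

theory Submission
  imports Defs
begin

text \<open>
Let \<open>D\<close> be the intersection of the sets \<open>C i\<close> and let \<open>r > 0\<close> be the infimum of the constants
\<open>\<rho> k\<close>. Since \<open>D\<close> consists of common fixed points, each step of the iteration
decreases the squared distance to every point of \<open>D\<close> by at least \<open>r\<close> times the squared length of
the step. This property (the locale \<open>strongly_fejer\<close>) makes the steps square summable, so the distance travelled
during a fixed number of steps tends to zero. Bounded gaps mean that there is one \<open>w\<close> such that
between the times \<open>k\<close> and \<open>k + w\<close> an operator belonging to \<open>C i\<close> is applied, whatever \<open>k\<close> and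
\<open>i\<close> are (\<open>bounded_gaps_hit_window\<close>). What regularity says about \<open>C i\<close> at those times therefore
carries over to all times.

For weak convergence, a weakly convergent subsequence is shifted to nearby visits of \<open>C i\<close>, so its
limit lies in every \<open>C i\<close>. Opial's argument (\<open>strongly_fejer_weakly_converges\<close>) shows that there
is only one such limit. That a bounded sequence has a weakly convergent subsequence is derived
from the fact that decreasing bounded closed convex sets have a common point.

For norm convergence, regularity of the operators and of the family gives that the distance from
\<open>x k\<close> to \<open>D\<close> tends to zero, and a Fejer monotone sequence with this property is Cauchy.

For linear convergence, regularity bounds the distance \<open>d k\<close> from \<open>x k\<close> to \<open>D\<close> by a multiple of
the distance travelled during the next \<open>L = Suc w\<close> steps. By the Cauchy-Schwarz inequality, the
square of the latter is at most \<open>L / r\<close> times the drop of \<open>d\<^sup>2\<close> over these steps, so \<open>d\<close> contracts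
by a fixed factor every \<open>L\<close> steps. This gives \<open>norm (x k - xs) \<le> c * q ^ k\<close> with some constant
\<open>c\<close>. To reach the constant \<open>2 * d 0\<close>, the ratio \<open>q\<close> is enlarged, depending on the starting
point: if \<open>x 0\<close> is not in \<open>D\<close>, then at least one step is nontrivial, and the energy lost in it makes
the inequality \<open>norm (x k - xs) \<le> 2 * d 0\<close> strict for every \<open>k\<close> (\<open>norm_diff_limit_less\<close>), so
the finitely many indices where the geometric bound is too weak are covered by a ratio close enough
to \<open>1\<close> (\<open>geometric_bound_with_constant\<close>).
\<close>

section \<open>Weak convergence in Hilbert spaces\<close>

text \<open>Points of the sets \<open>K n\<close> whose norms are almost minimal form a Cauchy sequence: the minimal norms increase
to a limit, and the midpoint of two of the points is in the larger of their sets, so its norm is not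
much smaller than theirs, and the parallelogram law makes their distance small. Both the projection onto a closed subspace and the
existence of weak limits rest on this lemma.\<close>

lemma decreasing_closed_convex_inter_nonempty:
  fixes K :: "nat \<Rightarrow> 'a::{real_inner,complete_space} set"
  assumes cl: "\<And>n. closed (K n)" and cv: "\<And>n. convex (K n)"
    and ne: "\<And>n. K n \<noteq> {}" and bd: "bounded (K 0)" and dec: "antimono K"
  shows "(\<Inter>n. K n) \<noteq> {}"
proof -
  define d where "d n = infdist 0 (K n)" for n
  have inc: "incseq d"
    using dec ne by (auto simp: d_def incseq_def monotone_def intro!: infdist_mono)
  obtain B where B: "\<And>z. z \<in> K 0 \<Longrightarrow> norm z \<le> B"
    using bd bounded_iff by metis
  have dB: "d n \<le> B" for n
  proof -
    obtain z where z: "z \<in> K n" using ne by blast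
    then have "z \<in> K 0" using dec by (auto simp: monotone_def)
    then show ?thesis using B[of z] infdist_le2[OF z, of 0 B] by (simp add: d_def)
  qed
  obtain l where l: "d \<longlonglongrightarrow> l" and dl: "\<And>n. d n \<le> l"
    using incseq_convergent[OF inc] dB by metis
  define e where "e n = inverse (real (Suc n))" for n
  have "\<exists>v \<in> K n. norm v < d n + e n" for n
    using cInf_lessD[of "(\<lambda>a. dist 0 a) ` K n" "d n + e n"] ne[of n]
    by (auto simp: d_def e_def infdist_notempty)
  then obtain v where vK: "\<And>n. v n \<in> K n" and vn: "\<And>n. norm (v n) < d n + e n"
    by metis
  define c where "c N = 4 * ((l + e N)\<^sup>2 - (d N)\<^sup>2)" for N
  have "e \<longlonglongrightarrow> 0"
    unfolding e_def by (rule LIMSEQ_inverse_real_of_nat)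
  then have "c \<longlonglongrightarrow> 4 * ((l + 0)\<^sup>2 - l\<^sup>2)"
    unfolding c_def by (intro tendsto_intros l)
  then have c0: "c \<longlonglongrightarrow> 0" by simp
  \<comment> \<open>The parallelogram law; \<open>l + e N\<close> bounds the norms of \<open>v i\<close> and \<open>v j\<close>, and \<open>d N\<close> that of their midpoint.\<close>
  have close: "(dist (v i) (v j))\<^sup>2 \<le> c N" if "i \<ge> N" "j \<ge> N" for i j N
  proof -
    have vN: "v k \<in> K N" "norm (v k) \<le> l + e N" if "k \<ge> N" for k
      using vK[of k] dec that vn[of k] dl[of k]
      by (auto simp: monotone_def e_def intro: order.trans[OF less_imp_le add_mono])
    have "(1/2) *\<^sub>R v i + (1/2) *\<^sub>R v j \<in> K N"
      by (rule convexD[OF cv]) (use vN that in auto)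
    then have "d N \<le> norm ((1/2) *\<^sub>R v i + (1/2) *\<^sub>R v j)"
      using infdist_le[of _ "K N" 0] by (auto simp: d_def)
    also have "\<dots> = norm (v i + v j) / 2"
      by (simp flip: scaleR_add_right)
    finally have "(2 * d N)\<^sup>2 \<le> (norm (v i + v j))\<^sup>2"
      by (intro power_mono) (auto simp: d_def infdist_nonneg)
    moreover have "(norm (v i - v j))\<^sup>2 + (norm (v i + v j))\<^sup>2 = 2 * (norm (v i))\<^sup>2 + 2 * (norm (v j))\<^sup>2"
      by (simp add: power2_norm_eq_inner inner_diff_left inner_diff_right inner_add_left inner_add_right inner_commute)
    moreover have "(norm (v i))\<^sup>2 \<le> (l + e N)\<^sup>2" "(norm (v j))\<^sup>2 \<le> (l + e N)\<^sup>2"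
      using vN that by (auto intro!: power_mono)
    ultimately show ?thesis by (simp add: c_def dist_norm algebra_simps)
  qed
  have "Cauchy v"
  proof (rule metric_CauchyI)
    fix \<epsilon> :: real assume "\<epsilon> > 0"
    then have "eventually (\<lambda>N. c N < \<epsilon>\<^sup>2) sequentially"
      using c0 by (intro order_tendstoD(2)) auto
    then obtain N where "c N < \<epsilon>\<^sup>2" by (auto simp: eventually_sequentially)
    then have "dist (v i) (v j) < \<epsilon>" if "i \<ge> N" "j \<ge> N" for i j
      using close[OF that] \<open>\<epsilon> > 0\<close> by (auto intro: power_less_imp_less_base[of _ 2])
    then show "\<exists>M. \<forall>i\<ge>M. \<forall>j\<ge>M. dist (v i) (v j) < \<epsilon>" by blast
  qed
  then obtain y where y: "v \<longlonglongrightarrow> y" using Cauchy_convergent convergent_def by blast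
  have "y \<in> K n" for n
  proof (rule Lim_in_closed_set[OF cl _ _ y])
    show "\<forall>\<^sub>F k in sequentially. v k \<in> K n"
      using vK dec by (auto simp: eventually_sequentially monotone_def intro!: exI[of _ n])
  qed simp
  then show ?thesis by blast
qed

text \<open>The nearest point \<open>p\<close> of \<open>M\<close> exists although closed balls need not be compact: it is common to the
sets of points of \<open>M\<close> that are almost nearest to \<open>h\<close>.\<close>

lemma closed_subspace_orthogonal_decomposition:
  fixes M :: "'a::{real_inner,complete_space} set"
  assumes "closed M" and M: "subspace M"
  obtains p where "p \<in> M" "\<And>v. v \<in> M \<Longrightarrow> (h - p) \<bullet> v = 0"
proof -
  define K where "K n = M \<inter> cball h (infdist h M + inverse (real (Suc n)))" for n
  have "(\<Inter>n. K n) \<noteq> {}"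
  proof (rule decreasing_closed_convex_inter_nonempty)
    show "closed (K n)" "convex (K n)" for n
      using assms by (auto simp: K_def subspace_imp_convex convex_Int)
    show "bounded (K 0)" by (auto simp: K_def)
    show "antimono K"
      unfolding K_def monotone_def
      by (intro allI impI Int_mono subset_cball add_mono le_imp_inverse_le) auto
    have "M \<noteq> {}" using M subspace_0 by blast
    then show "K n \<noteq> {}" for n
      using cInf_lessD[of "(\<lambda>a. dist h a) ` M" "infdist h M + inverse (real (Suc n))"]
      by (force simp: K_def infdist_notempty)
  qed
  then obtain p where p: "\<And>n. p \<in> K n" by blast
  have pM: "p \<in> M" using p[of 0] by (simp add: K_def)
  have "(\<lambda>n. infdist h M + inverse (real (Suc n))) \<longlonglongrightarrow> infdist h M + 0"
    by (intro tendsto_intros LIMSEQ_inverse_real_of_nat)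
  moreover have "dist h p \<le> infdist h M + inverse (real (Suc n))" for n
    using p[of n] by (simp add: K_def)
  ultimately have "dist h p \<le> infdist h M"
    by (metis (no_types, lifting) LIMSEQ_le_const add.right_neutral)
  then have near: "\<forall>z\<in>M. dist h p \<le> dist h z"
    using infdist_le order.trans by blast
  have le: "(h - p) \<bullet> v \<le> 0" if "v \<in> M" for v
    using any_closest_point_dot[OF subspace_imp_convex[OF M] \<open>closed M\<close> pM _ near, of "p + v"]
      subspace_add[OF M pM that] by simp
  \<comment> \<open>Both \<open>v\<close> and \<open>- v\<close> lie in \<open>M\<close>.\<close>
  have "(h - p) \<bullet> v = 0" if "v \<in> M" for v
    using le[OF that] le[OF subspace_neg[OF M that]] by simp
  with pM show thesis by (rule that)
qed

lemma subspace_convergent_inner: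
  fixes x :: "nat \<Rightarrow> 'a::real_inner"
  shows "subspace {h. convergent (\<lambda>k. x k \<bullet> h)}"
  by (auto simp: subspace_def inner_add_right convergent_const intro: convergent_add convergent_mult)

lemma closed_convergent_inner:
  fixes x :: "nat \<Rightarrow> 'a::real_inner"
  assumes "bounded (range x)"
  shows "closed {h. convergent (\<lambda>k. x k \<bullet> h)}"
proof -
  obtain B where B: "B > 0" "\<And>k. norm (x k) \<le> B"
    using assms unfolding bounded_pos by auto
  have "convergent (\<lambda>k. x k \<bullet> h)" if g: "\<And>j. convergent (\<lambda>k. x k \<bullet> g j)" "g \<longlonglongrightarrow> h" for g h
  proof (rule Cauchy_convergent, rule metric_CauchyI)
    fix \<epsilon> :: real assume "\<epsilon> > 0"
    then obtain j where j: "norm (g j - h) < \<epsilon> / (4 * B)"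
      using LIMSEQ_D[OF g(2), of "\<epsilon> / (4 * B)"] B by auto
    have "Cauchy (\<lambda>k. x k \<bullet> g j)"
      using g by (simp add: convergent_Cauchy)
    then obtain N where N: "\<And>a b. a \<ge> N \<Longrightarrow> b \<ge> N \<Longrightarrow> dist (x a \<bullet> g j) (x b \<bullet> g j) < \<epsilon> / 2"
      using \<open>\<epsilon> > 0\<close> unfolding Cauchy_def by (metis half_gt_zero)
    have close: "\<bar>x k \<bullet> g j - x k \<bullet> h\<bar> \<le> \<epsilon> / 4" for k
    proof -
      have "\<bar>x k \<bullet> (g j - h)\<bar> \<le> norm (x k) * norm (g j - h)"
        by (rule Cauchy_Schwarz_ineq2)
      also have "\<dots> \<le> B * (\<epsilon> / (4 * B))"
        using B j by (intro mult_mono) auto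
      finally show ?thesis using B by (simp add: inner_diff_right)
    qed
    have "dist (x a \<bullet> h) (x b \<bullet> h) < \<epsilon>" if "a \<ge> N" "b \<ge> N" for a b
      using N[OF that] close[of a] close[of b] unfolding dist_real_def by linarith
    then show "\<exists>M. \<forall>a\<ge>M. \<forall>b\<ge>M. dist (x a \<bullet> h) (x b \<bullet> h) < \<epsilon>" by blast
  qed
  then show ?thesis unfolding closed_sequential_limits by blast
qed

text \<open>The limits of the scalar sequences are given by inner products with a common point \<open>y\<close> of the closed
convex hulls of all tails: if the tail \<open>{n..}\<close> keeps \<open>x k \<bullet> h\<close> within \<open>\<epsilon>\<close> of its limit, then so does
its closed convex hull. No representation theorem for functionals is involved.\<close>

lemma convergent_inner_imp_weakly_convergent:
  fixes x :: "nat \<Rightarrow> 'a::{real_inner,complete_space}"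
  assumes bd: "bounded (range x)" and conv: "\<And>h. convergent (\<lambda>k. x k \<bullet> h)"
  obtains y where "weakly_converges_to x y"
proof -
  define K where "K n = closure (convex hull (x ` {n..}))" for n
  have "(\<Inter>n. K n) \<noteq> {}"
  proof (rule decreasing_closed_convex_inter_nonempty)
    show "closed (K n)" "convex (K n)" "K n \<noteq> {}" for n
      by (auto simp: K_def)
    show "bounded (K 0)"
      using bd by (auto simp: K_def bounded_convex_hull intro: bounded_subset)
    show "antimono K"
      unfolding K_def monotone_def by (intro allI impI closure_mono hull_mono image_mono) auto
  qed
  then obtain y where y: "\<And>n. y \<in> K n" by blast
  have "(\<lambda>k. x k \<bullet> h) \<longlonglongrightarrow> y \<bullet> h" for h
  proof -
    obtain l where l: "(\<lambda>k. x k \<bullet> h) \<longlonglongrightarrow> l" using conv by (auto simp: convergent_def)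
    have "\<bar>y \<bullet> h - l\<bar> \<le> \<epsilon>" if pos: "\<epsilon> > 0" for \<epsilon>
    proof -
      obtain N where N: "\<And>k. k \<ge> N \<Longrightarrow> \<bar>x k \<bullet> h - l\<bar> < \<epsilon>"
        using LIMSEQ_D[OF l pos] by (metis real_norm_def)
      define T where "T = {v. h \<bullet> v \<le> l + \<epsilon>} \<inter> {v. h \<bullet> v \<ge> l - \<epsilon>}"
      have "closed T" "convex T"
        by (auto simp: T_def closed_halfspace_le closed_halfspace_ge convex_halfspace_le
            convex_halfspace_ge convex_Int)
      moreover have "x k \<in> T" if "k \<ge> N" for k
        using N[OF that] by (auto simp: T_def inner_commute)
      ultimately have "K N \<subseteq> T"
        unfolding K_def by (intro closure_minimal hull_minimal) auto
      then show ?thesis using subsetD[OF _ y, of N T] by (auto simp: T_def inner_commute[of h])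
    qed
    then have "y \<bullet> h = l"
      using field_le_epsilon[of "\<bar>y \<bullet> h - l\<bar>" 0] by simp
    with l show ?thesis by simp
  qed
  then show thesis by (intro that[of y]) (simp add: weakly_converges_to_def)
qed

text \<open>By compactness of a countable product of intervals, a subsequence \<open>z\<close> can be chosen for which
\<open>z k \<bullet> x i\<close> converges as \<open>k \<rightarrow> \<infinity>\<close> for every \<open>i\<close>. The vectors \<open>h\<close> for which \<open>z k \<bullet> h\<close> converges
form a closed subspace \<open>G\<close> that contains every \<open>x i\<close>. It also contains the orthogonal complement of
\<open>G\<close>, as \<open>z k \<bullet> h = 0\<close> there, so it is the whole space.\<close>

lemma bounded_imp_weakly_convergent_subsequence:
  fixes x :: "nat \<Rightarrow> 'a::{real_inner,complete_space}"
  assumes bd: "bounded (range x)"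
  obtains r y where "strict_mono (r :: nat \<Rightarrow> nat)" "weakly_converges_to (x \<circ> r) y"
proof -
  obtain B where B: "B > 0" "\<And>k. norm (x k) \<le> B"
    using bd unfolding bounded_pos by auto
  define P where "P = PiE (UNIV :: nat set) (\<lambda>_. {-(B * B)..B * B :: real})"
  have "compact P"
  proof -
    have "compactin (product_topology (\<lambda>_. euclidean) (UNIV :: nat set)) P"
      unfolding P_def compactin_PiE by auto
    then show ?thesis by (simp add: euclidean_product_topology)
  qed
  then have "seq_compact P" by (rule compact_imp_seq_compact)
  define f where "f k = (\<lambda>i. x k \<bullet> x i)" for k
  have "\<bar>x k \<bullet> x i\<bar> \<le> B * B" for k i
    using Cauchy_Schwarz_ineq2[of "x k" "x i"] mult_mono[OF B(2)[of k] B(2)[of i]] B(1) by simp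
  then have "f k \<in> P" for k
    by (auto simp: P_def f_def abs_le_iff minus_le_iff)
  then obtain g r where r: "strict_mono r" and g: "(f \<circ> r) \<longlonglongrightarrow> g"
    using \<open>seq_compact P\<close> unfolding seq_compact_def by blast
  define z where "z = x \<circ> r"
  define G where "G = {h. convergent (\<lambda>k. z k \<bullet> h)}"
  have zbd: "bounded (range z)"
    using bd by (rule bounded_subset) (auto simp: z_def)
  have xG: "x i \<in> G" for i
  proof -
    have "(\<lambda>k. (f \<circ> r) k i) \<longlonglongrightarrow> g i"
      by (rule continuous_on_tendsto_compose[OF continuous_on_product_coordinates g]) auto
    then show ?thesis by (auto simp: G_def f_def z_def convergent_def)
  qed
  have sub: "subspace G" unfolding G_def by (rule subspace_convergent_inner)
  have cl: "closed G" unfolding G_def by (rule closed_convergent_inner[OF zbd])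
  have "h \<in> G" for h
  proof -
    obtain p where p: "p \<in> G" "\<And>v. v \<in> G \<Longrightarrow> (h - p) \<bullet> v = 0"
      by (rule closed_subspace_orthogonal_decomposition[OF cl sub, where h=h]) blast
    have "z k \<bullet> (h - p) = 0" for k
      using p(2)[OF xG] by (simp add: z_def inner_commute[of _ "h - p"])
    then have "h - p \<in> G" by (simp add: G_def convergent_const)
    then show ?thesis using subspace_add[OF sub p(1)] by fastforce
  qed
  then have "convergent (\<lambda>k. z k \<bullet> h)" for h by (simp add: G_def)
  from convergent_inner_imp_weakly_convergent[OF zbd this]
  obtain y where "weakly_converges_to z y" .
  with r show thesis unfolding z_def by (rule that)
qed

lemma weakly_converges_to_subsequence:
  assumes "weakly_converges_to x y" "strict_mono r"
  shows "weakly_converges_to (x \<circ> r) y"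
  unfolding weakly_converges_to_def
proof
  fix h
  have "((\<lambda>k. x k \<bullet> h) \<circ> r) \<longlonglongrightarrow> y \<bullet> h"
    using assms by (intro LIMSEQ_subseq_LIMSEQ) (simp_all add: weakly_converges_to_def)
  then show "(\<lambda>k. (x \<circ> r) k \<bullet> h) \<longlonglongrightarrow> y \<bullet> h"
    by (simp add: o_def)
qed

lemma weakly_converges_to_norm_close:
  assumes x: "weakly_converges_to x y" and close: "(\<lambda>k. norm (x' k - x k)) \<longlonglongrightarrow> 0"
  shows "weakly_converges_to x' y"
  unfolding weakly_converges_to_def
proof
  fix h
  have "(\<lambda>k. x' k - x k) \<longlonglongrightarrow> 0"
    using close by (simp add: tendsto_norm_zero_iff)
  then have "(\<lambda>k. (x' k - x k) \<bullet> h) \<longlonglongrightarrow> 0 \<bullet> h"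
    by (intro tendsto_inner tendsto_const)
  moreover have "(\<lambda>k. x k \<bullet> h) \<longlonglongrightarrow> y \<bullet> h"
    using x by (simp add: weakly_converges_to_def)
  ultimately have "(\<lambda>k. x k \<bullet> h + (x' k - x k) \<bullet> h) \<longlonglongrightarrow> y \<bullet> h + 0 \<bullet> h"
    by (intro tendsto_add)
  then show "(\<lambda>k. x' k \<bullet> h) \<longlonglongrightarrow> y \<bullet> h"
    by (simp add: inner_diff_left)
qed

text \<open>If some inner products \<open>x k \<bullet> h\<close> did not converge to \<open>y \<bullet> h\<close>, a subsequence would stay away from this
value. By weak compactness it would have a weak cluster point, which is \<open>y\<close> by hypothesis.\<close>

lemma weakly_converges_toI_subsequences:
  fixes x :: "nat \<Rightarrow> 'a::{real_inner,complete_space}"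
  assumes bd: "bounded (range x)"
    and cluster: "\<And>r y'. strict_mono (r :: nat \<Rightarrow> nat) \<Longrightarrow> weakly_converges_to (x \<circ> r) y' \<Longrightarrow> y' = y"
  shows "weakly_converges_to x y"
  unfolding weakly_converges_to_def
proof (rule allI, rule ccontr)
  fix h assume "\<not> (\<lambda>k. x k \<bullet> h) \<longlonglongrightarrow> y \<bullet> h"
  then obtain \<epsilon> where \<epsilon>: "\<epsilon> > 0" "\<And>N. \<exists>k\<ge>N. \<not> dist (x k \<bullet> h) (y \<bullet> h) < \<epsilon>"
    unfolding LIMSEQ_def by blast
  then have "infinite {k. \<not> dist (x k \<bullet> h) (y \<bullet> h) < \<epsilon>}"
    unfolding infinite_nat_iff_unbounded_le by blast
  then obtain p :: "nat \<Rightarrow> nat" where p: "strict_mono p" "\<And>k. \<not> dist (x (p k) \<bullet> h) (y \<bullet> h) < \<epsilon>"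
    using infinite_enumerate[of "{k. \<not> dist (x k \<bullet> h) (y \<bullet> h) < \<epsilon>}"] by auto
  have "bounded (range (x \<circ> p))"
    using bd by (rule bounded_subset) auto
  then obtain r y' where r: "strict_mono (r :: nat \<Rightarrow> nat)" "weakly_converges_to ((x \<circ> p) \<circ> r) y'"
    by (rule bounded_imp_weakly_convergent_subsequence)
  then have "y' = y"
    using cluster[of "p \<circ> r" y'] p(1) by (simp add: o_assoc strict_mono_o)
  then have "(\<lambda>k. x (p (r k)) \<bullet> h) \<longlonglongrightarrow> y \<bullet> h"
    using r(2) by (simp add: weakly_converges_to_def o_def)
  then have "\<exists>N. \<forall>k\<ge>N. dist (x (p (r k)) \<bullet> h) (y \<bullet> h) < \<epsilon>"
    using \<epsilon>(1) by (rule metric_LIMSEQ_D)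
  then show False using p(2) by blast
qed

section \<open>Distances to a set and geometric bounds\<close>

text \<open>Replaces the nearest point of \<open>C\<close> to \<open>x\<close> in estimates: an inequality that depends continuously on the
distance to the points of \<open>C\<close> passes to the infimum, whether or not it is attained.\<close>

lemma le_infdist_if_le_dist:
  fixes \<phi> :: "real \<Rightarrow> real"
  assumes ne: "C \<noteq> {}" and cont: "isCont \<phi> (infdist x C)"
    and le: "\<And>z. z \<in> C \<Longrightarrow> c \<le> \<phi> (dist x z)"
  shows "c \<le> \<phi> (infdist x C)"
proof -
  have "\<exists>z\<in>C. dist x z < infdist x C + inverse (real (Suc k))" for k
    using cInf_lessD[of "(\<lambda>a. dist x a) ` C" "infdist x C + inverse (real (Suc k))"] ne
    by (auto simp: infdist_notempty)
  then obtain z where z: "\<And>k. z k \<in> C" "\<And>k. dist x (z k) < infdist x C + inverse (real (Suc k))"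
    by metis
  have "(\<lambda>k. infdist x C + inverse (real (Suc k))) \<longlonglongrightarrow> infdist x C + 0"
    by (intro tendsto_intros LIMSEQ_inverse_real_of_nat)
  then have "(\<lambda>k. infdist x C + inverse (real (Suc k))) \<longlonglongrightarrow> infdist x C"
    by simp
  then have "(\<lambda>k. dist x (z k)) \<longlonglongrightarrow> infdist x C"
    by (rule tendsto_sandwich[OF _ _ tendsto_const, rotated -1])
       (intro always_eventually allI infdist_le z(1) less_imp_le[OF z(2)])+
  then have "(\<lambda>k. \<phi> (dist x (z k))) \<longlonglongrightarrow> \<phi> (infdist x C)"
    by (rule isCont_tendsto_compose[OF cont])
  then show ?thesis
    by (rule LIMSEQ_le_const) (use le[OF z(1)] in blast)
qed

lemma geometric_bound_from_blocks:
  fixes d :: "nat \<Rightarrow> real"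
  assumes dec: "decseq d" and nonneg: "0 \<le> d 0" and \<theta>: "0 < \<theta>" "\<theta> < 1" and L: "0 < L"
    and block: "\<And>k. d (k + L) \<le> \<theta> * d k"
  obtains c q where "0 < q" "q < 1" "\<And>k. d k \<le> c * q ^ k"
proof -
  define q where "q = root L \<theta>"
  have q: "0 < q" "q < 1" "q ^ L = \<theta>"
    using \<theta> L by (auto simp: q_def)
  have blocks: "d (j + L * i) \<le> \<theta> ^ i * d j" for i j
  proof (induction i)
    case (Suc i)
    have "d (j + L * Suc i) \<le> \<theta> * d (j + L * i)"
      using block[of "j + L * i"] by (simp add: add_ac)
    also have "\<dots> \<le> \<theta> * (\<theta> ^ i * d j)" using Suc \<theta> by (intro mult_left_mono) auto
    finally show ?case by (simp add: mult_ac)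
  qed simp
  \<comment> \<open>Dividing by \<open>\<theta> = q ^ L\<close> pays for the incomplete block of \<open>k mod L < L\<close> steps.\<close>
  have "d k \<le> (d 0 / \<theta>) * q ^ k" for k
  proof -
    have "d k \<le> \<theta> ^ (k div L) * d (k mod L)"
      using blocks[of "k mod L" "k div L"] by simp
    also have "\<dots> \<le> \<theta> ^ (k div L) * d 0"
      using dec \<theta> by (intro mult_left_mono) (auto simp: decseq_def)
    also have "\<dots> = (d 0 / \<theta>) * (q ^ L * (q ^ L) ^ (k div L))"
      using \<theta> q by simp
    also have "\<dots> \<le> (d 0 / \<theta>) * (q ^ (k mod L) * (q ^ L) ^ (k div L))"
      using nonneg \<theta> q L
      by (intro mult_left_mono mult_right_mono power_decreasing) auto
    also have "q ^ (k mod L) * (q ^ L) ^ (k div L) = q ^ k"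
      by (simp flip: power_mult power_add)
    finally show ?thesis .
  qed
  with q(1,2) show thesis by (rule that)
qed

text \<open>The ratio \<open>u\<close> between \<open>q\<close> and \<open>1\<close> absorbs the constant \<open>c\<close> from some index \<open>N\<close> on. Each of the
indices below \<open>N\<close> allows every ratio close enough to \<open>1\<close>, because \<open>a k < B\<close> is strict.\<close>

lemma geometric_bound_with_constant:
  fixes a :: "nat \<Rightarrow> real"
  assumes B: "0 < B" and less: "\<And>k. a k < B"
    and q: "0 < q" "q < 1" and geo: "\<And>k. a k \<le> c * q ^ k"
  obtains q' where "0 < q'" "q' < 1" "\<And>k. a k \<le> B * q' ^ k"
proof -
  define u where "u = (q + 1) / 2"
  have u: "q < u" "u < 1" "0 < u" using q by (auto simp: u_def)
  have "(\<lambda>k. c * (q / u) ^ k) \<longlonglongrightarrow> c * 0"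
    using q u by (intro tendsto_intros LIMSEQ_power_zero) auto
  then have "eventually (\<lambda>k. c * (q / u) ^ k < B) sequentially"
    using B by (intro order_tendstoD(2)) auto
  then obtain N where N: "\<And>k. k \<ge> N \<Longrightarrow> c * (q / u) ^ k < B"
    by (auto simp: eventually_sequentially)
  have tail: "a k \<le> B * u ^ k" if "k \<ge> N" for k
  proof -
    have "a k \<le> c * (q / u) ^ k * u ^ k"
      using geo[of k] u by (simp add: power_divide)
    also have "\<dots> \<le> B * u ^ k" using N[OF that] u by (intro mult_right_mono) auto
    finally show ?thesis .
  qed
  have "eventually (\<lambda>t. a k < B * t ^ k) (at_left 1)" for k
  proof (rule order_tendstoD(1))
    have "((\<lambda>t. B * t ^ k) \<longlongrightarrow> B * 1 ^ k) (at_left 1)" by (intro tendsto_intros)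
    then show "((\<lambda>t. B * t ^ k) \<longlongrightarrow> B) (at_left 1)" by simp
  qed (rule less)
  then have "eventually (\<lambda>t. \<forall>k\<in>{..<N}. a k < B * t ^ k) (at_left 1)"
    by (intro eventually_ball_finite) auto
  moreover have "eventually (\<lambda>t. t \<in> {u<..<1}) (at_left (1::real))"
    by (rule eventually_at_left_real[OF u(2)])
  ultimately have "eventually (\<lambda>t. t \<in> {u<..<1} \<and> (\<forall>k\<in>{..<N}. a k < B * t ^ k)) (at_left 1)"
    by eventually_elim auto
  then obtain t where t: "u < t" "t < 1" "\<And>k. k < N \<Longrightarrow> a k < B * t ^ k"
    using eventually_happens'[OF trivial_limit_at_left_real] by fastforce
  have "a k \<le> B * t ^ k" for k
  proof (cases "k < N")
    case False
    then have "a k \<le> B * u ^ k" by (intro tail) auto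
    also have "\<dots> \<le> B * t ^ k" using t u B by (intro mult_left_mono power_mono) auto
    finally show ?thesis .
  qed (use t(3) in \<open>auto intro: less_imp_le\<close>)
  then show thesis using t u by (intro that[of t]) auto
qed

section \<open>Strongly Fejer monotone sequences\<close>

locale strongly_fejer =
  fixes C :: "'a::real_inner set" and x :: "nat \<Rightarrow> 'a" and r :: real
  assumes nonempty: "C \<noteq> {}" and r_pos: "0 < r"
    and step: "\<And>k z. z \<in> C \<Longrightarrow>
      (norm (x (Suc k) - z))\<^sup>2 \<le> (norm (x k - z))\<^sup>2 - r * (norm (x (Suc k) - x k))\<^sup>2"
begin

definition path_length :: "nat \<Rightarrow> nat \<Rightarrow> real" where
  "path_length k L = (\<Sum>i<L. norm (x (Suc (k + i)) - x (k + i)))"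

text \<open>The defining inequality summed over \<open>l\<close> steps. Its sum of squares makes the steps tend to zero and
pays for the distance travelled in \<open>infdist_path_length\<close>.\<close>

lemma energy:
  assumes "z \<in> C"
  shows "(norm (x (k + l) - z))\<^sup>2 + r * (\<Sum>i<l. (norm (x (Suc (k + i)) - x (k + i)))\<^sup>2) \<le> (norm (x k - z))\<^sup>2"
proof (induction l)
  case (Suc l)
  then show ?case using step[OF assms, of "k + l"] by (simp add: algebra_simps)
qed simp

lemma norm_antimono:
  assumes "z \<in> C" "k \<le> l"
  shows "norm (x l - z) \<le> norm (x k - z)"
proof -
  have "0 \<le> r * (\<Sum>i<l - k. (norm (x (Suc (k + i)) - x (k + i)))\<^sup>2)"
    using r_pos by (simp add: sum_nonneg)
  then have "(norm (x l - z))\<^sup>2 \<le> (norm (x k - z))\<^sup>2"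
    using energy[OF assms(1), of k "l - k"] unfolding le_add_diff_inverse[OF assms(2)] by linarith
  then show ?thesis by (rule power2_le_imp_le) simp
qed

lemma bounded_range: "bounded (range x)"
proof -
  obtain z where "z \<in> C" using nonempty by blast
  then have "dist z (x k) \<le> norm (x 0 - z)" for k
    using norm_antimono[of z 0 k] by (simp add: dist_norm norm_minus_commute)
  then show ?thesis unfolding bounded_def by blast
qed

lemma convergent_norm:
  assumes "z \<in> C"
  shows "convergent (\<lambda>k. norm (x k - z))"
proof (rule Bseq_monoseq_convergent)
  show "Bseq (\<lambda>k. norm (x k - z))"
    using norm_antimono[OF assms, of 0] by (intro BseqI'[where K="norm (x 0 - z)"]) auto
  show "monoseq (\<lambda>k. norm (x k - z))"
    using norm_antimono[OF assms] by (auto simp: monoseq_def)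
qed

lemma steps_tendsto_0: "(\<lambda>k. norm (x (Suc k) - x k)) \<longlonglongrightarrow> 0"
proof -
  obtain z where z: "z \<in> C" using nonempty by blast
  have "summable (\<lambda>k. (norm (x (Suc k) - x k))\<^sup>2)"
  proof (rule summableI_nonneg_bounded)
    fix l
    have "r * (\<Sum>i<l. (norm (x (Suc i) - x i))\<^sup>2) \<le> (norm (x 0 - z))\<^sup>2"
      using energy[OF z, of 0 l] zero_le_power2[of "norm (x l - z)"] unfolding add_0 by linarith
    then show "(\<Sum>i<l. (norm (x (Suc i) - x i))\<^sup>2) \<le> (norm (x 0 - z))\<^sup>2 / r"
      using r_pos by (simp add: pos_le_divide_eq mult.commute)
  qed simp
  then have "(\<lambda>k. sqrt ((norm (x (Suc k) - x k))\<^sup>2)) \<longlonglongrightarrow> sqrt 0"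
    by (intro tendsto_intros summable_LIMSEQ_zero)
  then show ?thesis by simp
qed

lemma path_length_tendsto_0: "(\<lambda>k. path_length k L) \<longlonglongrightarrow> 0"
proof -
  have "(\<lambda>k. path_length k L) \<longlonglongrightarrow> (\<Sum>i<L. 0)"
    unfolding path_length_def
    using LIMSEQ_ignore_initial_segment[OF steps_tendsto_0] by (intro tendsto_sum) simp
  then show ?thesis by simp
qed

lemma path_length_nonneg: "0 \<le> path_length k L"
  by (simp add: path_length_def sum_nonneg)

lemma norm_step_le_path_length:
  assumes "k \<le> b" "b < k + L"
  shows "norm (x (Suc b) - x b) \<le> path_length k L"
  using member_le_sum[of "b - k" "{..<L}" "\<lambda>i. norm (x (Suc (k + i)) - x (k + i))"] assms
  by (simp add: path_length_def)

lemma norm_diff_le_path_length: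
  assumes "k \<le> b" "b \<le> k + L"
  shows "norm (x b - x k) \<le> path_length k L"
proof -
  have "norm (x (k + l) - x k) \<le> path_length k l" for l
  proof (induction l)
    case (Suc l)
    have "norm (x (k + Suc l) - x k) \<le> norm (x (Suc (k + l)) - x (k + l)) + norm (x (k + l) - x k)"
      using norm_triangle_ineq[of "x (Suc (k + l)) - x (k + l)" "x (k + l) - x k"] by simp
    then show ?case using Suc by (simp add: path_length_def)
  qed (simp add: path_length_def)
  from this[of "b - k"] have "norm (x b - x k) \<le> path_length k (b - k)"
    using assms(1) by simp
  also have "\<dots> \<le> path_length k L"
    unfolding path_length_def using assms by (intro sum_mono2) auto
  finally show ?thesis .
qed

lemma infdist_antimono:
  assumes "k \<le> l"
  shows "infdist (x l) C \<le> infdist (x k) C"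
proof (rule le_infdist_if_le_dist[OF nonempty, where \<phi>="\<lambda>t. t"])
  fix z assume "z \<in> C"
  then show "infdist (x l) C \<le> dist (x k) z"
    using norm_antimono[OF _ assms, of z] infdist_le[of z C "x l"] by (simp add: dist_norm)
qed simp

text \<open>All iterates from time \<open>k\<close> on stay in every ball around a point of \<open>C\<close> that contains \<open>x k\<close>.\<close>

lemma norm_diff_le_infdist:
  assumes "k \<le> l"
  shows "norm (x k - x l) \<le> 2 * infdist (x k) C"
proof (rule le_infdist_if_le_dist[OF nonempty, where \<phi>="\<lambda>t. 2 * t"])
  fix z assume z: "z \<in> C"
  have "norm (x k - x l) \<le> norm (x k - z) + norm (x l - z)"
    using dist_triangle2[of "x k" "x l" z] by (simp only: dist_norm)
  then show "norm (x k - x l) \<le> 2 * dist (x k) z"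
    using norm_antimono[OF z assms] unfolding dist_norm by linarith
qed (intro continuous_intros)

lemma norm_diff_limit_le_infdist:
  assumes "x \<longlonglongrightarrow> xs"
  shows "norm (x k - xs) \<le> 2 * infdist (x k) C"
proof (rule LIMSEQ_le_const2)
  show "(\<lambda>l. norm (x k - x l)) \<longlonglongrightarrow> norm (x k - xs)"
    by (intro tendsto_intros assms)
qed (intro exI[of _ k] allI impI norm_diff_le_infdist)

text \<open>By the Cauchy-Schwarz inequality, the squared length of a path of \<open>L\<close> steps is at most \<open>L\<close> times the
sum of the squared steps, which is bounded by the drop of the squared distance to each point of \<open>C\<close>.
Hence it is bounded, up to the factor \<open>L / r\<close>, by the drop of the squared distance to \<open>C\<close>.\<close>

lemma infdist_path_length:
  "r * (path_length k L)\<^sup>2 + L * (infdist (x (k + L)) C)\<^sup>2 \<le> L * (infdist (x k) C)\<^sup>2"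
proof (rule le_infdist_if_le_dist[OF nonempty, where \<phi>="\<lambda>t. L * t\<^sup>2"])
  fix z assume z: "z \<in> C"
  let ?S = "\<Sum>i<L. (norm (x (Suc (k + i)) - x (k + i)))\<^sup>2"
  have "(path_length k L)\<^sup>2 \<le> L * ?S"
    unfolding path_length_def
    using sum_squared_le_sum_of_squares[of "\<lambda>i. norm (x (Suc (k + i)) - x (k + i))" "{..<L}"]
    by (simp add: mult.commute)
  then have "r * (path_length k L)\<^sup>2 \<le> L * (r * ?S)"
    using mult_left_mono[of "(path_length k L)\<^sup>2" "L * ?S" r] r_pos by (simp add: mult.left_commute)
  moreover have "(infdist (x (k + L)) C)\<^sup>2 \<le> (norm (x (k + L) - z))\<^sup>2"
    using infdist_le[OF z, of "x (k + L)"] by (intro power_mono) (auto simp: dist_norm infdist_nonneg)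
  then have "r * ?S + (infdist (x (k + L)) C)\<^sup>2 \<le> (dist (x k) z)\<^sup>2"
    using energy[OF z, of k L] by (simp add: dist_norm)
  then have "L * (r * ?S + (infdist (x (k + L)) C)\<^sup>2) \<le> L * (dist (x k) z)\<^sup>2"
    by (rule mult_left_mono) simp
  ultimately show "r * (path_length k L)\<^sup>2 + L * (infdist (x (k + L)) C)\<^sup>2 \<le> L * (dist (x k) z)\<^sup>2"
    by (simp add: algebra_simps)
qed (intro continuous_intros)

text \<open>With \<open>d\<close> and \<open>e\<close> the distances to \<open>C\<close> before and after \<open>L\<close> steps, the hypothesis and
\<open>infdist_path_length\<close> give \<open>d\<^sup>2 \<le> (K\<^sup>2 * L / r) * (d\<^sup>2 - e\<^sup>2)\<close>, so that \<open>e\<close> is at most a fixed fraction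
of \<open>d\<close>.\<close>

lemma infdist_contracts:
  assumes K: "0 < K" and L: "0 < L" and le: "\<And>k. infdist (x k) C \<le> K * path_length k L"
  obtains \<theta> where "0 < \<theta>" "\<theta> < 1" "\<And>k. infdist (x (k + L)) C \<le> \<theta> * infdist (x k) C"
proof -
  \<comment> \<open>Adding \<open>1\<close> ensures \<open>M > 1\<close>, so that \<open>1 - 1 / M\<close> is positive.\<close>
  define M where "M = K\<^sup>2 * L / r + 1"
  have M: "M > 1" using K L r_pos by (simp add: M_def)
  have "infdist (x (k + L)) C \<le> sqrt (1 - 1 / M) * infdist (x k) C" for k
  proof -
    define d e where "d = infdist (x k) C" and "e = infdist (x (k + L)) C"
    have de: "0 \<le> e" "e \<le> d" by (auto simp: d_def e_def infdist_nonneg infdist_antimono)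
    have "d\<^sup>2 \<le> (K * path_length k L)\<^sup>2"
      using le[of k] by (intro power_mono) (auto simp: d_def infdist_nonneg)
    also have "\<dots> = K\<^sup>2 / r * (r * (path_length k L)\<^sup>2)"
      using r_pos by (simp add: power_mult_distrib)
    also have "\<dots> \<le> K\<^sup>2 / r * (L * (d\<^sup>2 - e\<^sup>2))"
      using infdist_path_length[of k L] r_pos
      by (intro mult_left_mono) (auto simp: d_def e_def algebra_simps)
    also have "\<dots> = (M - 1) * (d\<^sup>2 - e\<^sup>2)" by (simp add: M_def)
    finally have "d\<^sup>2 \<le> (M - 1) * (d\<^sup>2 - e\<^sup>2)" .
    moreover have "e\<^sup>2 \<le> d\<^sup>2" using de by (intro power_mono) auto
    ultimately have "d\<^sup>2 \<le> M * (d\<^sup>2 - e\<^sup>2)" by (simp add: algebra_simps)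
    then have "e\<^sup>2 \<le> (1 - 1 / M) * d\<^sup>2" using M by (simp add: field_simps)
    then have "sqrt (e\<^sup>2) \<le> sqrt ((1 - 1 / M) * d\<^sup>2)" by (rule real_sqrt_le_mono)
    then show ?thesis using de by (simp add: real_sqrt_mult d_def e_def)
  qed
  then show thesis using M by (intro that[of "sqrt (1 - 1 / M)"]) auto
qed

text \<open>A sequence whose limit differs from \<open>x 0\<close> makes a nontrivial step, and this step costs a fixed amount
\<open>\<sigma>\<close> of the squared distance to each \<open>z\<close> in \<open>C\<close>. So if \<open>x 0\<close> has distance \<open>t\<close> from \<open>z\<close>, the limit has
distance at most \<open>sqrt (t\<^sup>2 - \<sigma>)\<close> from \<open>z\<close>, while \<open>x k\<close> has distance at most \<open>t\<close>. Passing to the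
infimum over \<open>z\<close> preserves the strictness since \<open>\<sigma>\<close> is the same for all \<open>z\<close>.\<close>

lemma norm_diff_limit_less:
  assumes lim: "x \<longlonglongrightarrow> xs" and ne: "x 0 \<noteq> xs" and pos: "0 < infdist (x 0) C"
  shows "norm (x k - xs) < 2 * infdist (x 0) C"
proof -
  have "\<exists>m. x (Suc m) \<noteq> x m"
  proof (rule ccontr)
    assume "\<not> ?thesis"
    then have "x k = x 0" for k by (induction k) auto
    then have "x = (\<lambda>_. x 0)" by blast
    then show False using lim ne LIMSEQ_const_iff by metis
  qed
  then obtain m where m: "x (Suc m) \<noteq> x m" by blast
  define \<sigma> where "\<sigma> = r * (norm (x (Suc m) - x m))\<^sup>2"
  have \<sigma>: "\<sigma> > 0" using m r_pos by (simp add: \<sigma>_def)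
  let ?\<phi> = "\<lambda>t. t + sqrt (t\<^sup>2 - \<sigma>)"
  have "norm (x k - xs) \<le> ?\<phi> (infdist (x 0) C)"
  proof (rule le_infdist_if_le_dist[OF nonempty])
    show "isCont ?\<phi> (infdist (x 0) C)" by (intro continuous_intros)
    fix z assume z: "z \<in> C"
    have "norm (x l - z) \<le> sqrt ((norm (x 0 - z))\<^sup>2 - \<sigma>)" if "l \<ge> Suc m" for l
    proof (rule real_le_rsqrt)
      have "(norm (x l - z))\<^sup>2 \<le> (norm (x (Suc m) - z))\<^sup>2" "(norm (x m - z))\<^sup>2 \<le> (norm (x 0 - z))\<^sup>2"
        using that by (auto intro!: power_mono norm_antimono[OF z])
      then show "(norm (x l - z))\<^sup>2 \<le> (norm (x 0 - z))\<^sup>2 - \<sigma>"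
        using step[OF z, of m] unfolding \<sigma>_def by linarith
    qed
    moreover have "(\<lambda>l. norm (x l - z)) \<longlonglongrightarrow> norm (xs - z)"
      by (intro tendsto_intros lim)
    ultimately have "norm (xs - z) \<le> sqrt ((norm (x 0 - z))\<^sup>2 - \<sigma>)"
      by (intro LIMSEQ_le_const2) blast+
    moreover have "norm (x k - xs) \<le> norm (x k - z) + norm (xs - z)"
      using dist_triangle2[of "x k" xs z] by (simp only: dist_norm)
    ultimately show "norm (x k - xs) \<le> ?\<phi> (dist (x 0) z)"
      using norm_antimono[OF z, of 0 k] unfolding dist_norm by linarith
  qed
  also have "sqrt ((infdist (x 0) C)\<^sup>2 - \<sigma>) < infdist (x 0) C"
    using \<sigma> pos by (intro real_less_lsqrt) auto
  finally show ?thesis by simp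
qed

end

text \<open>Opial's argument. If \<open>y\<close> and \<open>y'\<close> are weak cluster points, both lie in \<open>C\<close>, so the distances from
\<open>x k\<close> to \<open>y\<close> and to \<open>y'\<close> converge. The difference of their squares is an affine function of
\<open>x k \<bullet> (y - y')\<close>, which therefore converges as well, and its limits along the two subsequences must
agree: \<open>y \<bullet> (y - y') = y' \<bullet> (y - y')\<close>.\<close>

lemma strongly_fejer_weakly_converges:
  fixes x :: "nat \<Rightarrow> 'a::{real_inner,complete_space}"
  assumes "strongly_fejer C x r"
    and cluster: "\<And>p y. strict_mono (p :: nat \<Rightarrow> nat) \<Longrightarrow> weakly_converges_to (x \<circ> p) y \<Longrightarrow> y \<in> C"
  shows "\<exists>y\<in>C. weakly_converges_to x y"
proof -
  interpret strongly_fejer C x r by fact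
  obtain p y where p: "strict_mono (p :: nat \<Rightarrow> nat)" and y: "weakly_converges_to (x \<circ> p) y"
    by (rule bounded_imp_weakly_convergent_subsequence[OF bounded_range])
  have yC: "y \<in> C" by (rule cluster[OF p y])
  have "weakly_converges_to x y"
  proof (rule weakly_converges_toI_subsequences[OF bounded_range])
    fix q y' assume q: "strict_mono (q :: nat \<Rightarrow> nat)" and y': "weakly_converges_to (x \<circ> q) y'"
    have "y' \<in> C" by (rule cluster[OF q y'])
    then obtain a b where "(\<lambda>k. norm (x k - y)) \<longlonglongrightarrow> a" "(\<lambda>k. norm (x k - y')) \<longlonglongrightarrow> b"
      using convergent_norm[OF yC] convergent_norm[of y'] unfolding convergent_def by blast
    then have "(\<lambda>k. ((norm (x k - y'))\<^sup>2 - (norm (x k - y))\<^sup>2 - (norm y')\<^sup>2 + (norm y)\<^sup>2) / 2)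
        \<longlonglongrightarrow> (b\<^sup>2 - a\<^sup>2 - (norm y')\<^sup>2 + (norm y)\<^sup>2) / 2"
      by (intro tendsto_intros) auto
    moreover have "((norm (x k - y'))\<^sup>2 - (norm (x k - y))\<^sup>2 - (norm y')\<^sup>2 + (norm y)\<^sup>2) / 2
        = x k \<bullet> (y - y')" for k
      by (simp add: power2_norm_eq_inner inner_diff_left inner_diff_right inner_commute)
    ultimately obtain l where l: "(\<lambda>k. x k \<bullet> (y - y')) \<longlonglongrightarrow> l" by auto
    have "y \<bullet> (y - y') = l"
      using LIMSEQ_unique[OF _ LIMSEQ_subseq_LIMSEQ[OF l p]] y
      by (simp add: weakly_converges_to_def o_def)
    moreover have "y' \<bullet> (y - y') = l"
      using LIMSEQ_unique[OF _ LIMSEQ_subseq_LIMSEQ[OF l q]] y'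
      by (simp add: weakly_converges_to_def o_def)
    ultimately have "(y - y') \<bullet> (y - y') = 0" by (simp only: inner_diff_left)
    then show "y' = y" by simp
  qed
  with yC show ?thesis by blast
qed

lemma strongly_fejer_converges:
  fixes x :: "nat \<Rightarrow> 'a::{real_inner,complete_space}"
  assumes "strongly_fejer C x r" and cl: "closed C"
    and d0: "(\<lambda>k. infdist (x k) C) \<longlonglongrightarrow> 0"
  shows "\<exists>xs\<in>C. x \<longlonglongrightarrow> xs"
proof -
  interpret strongly_fejer C x r by fact
  have "Cauchy x"
  proof (rule metric_CauchyI)
    fix \<epsilon> :: real assume "\<epsilon> > 0"
    then obtain N where N: "infdist (x N) C < \<epsilon> / 4"
      using order_tendstoD(2)[OF d0, of "\<epsilon> / 4"] by (auto simp: eventually_sequentially)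
    have "dist (x a) (x b) < \<epsilon>" if "a \<ge> N" "b \<ge> N" for a b
      using norm_diff_le_infdist[OF that(1)] norm_diff_le_infdist[OF that(2)] N
        dist_triangle3[of "x a" "x b" "x N"] by (simp add: dist_norm)
    then show "\<exists>N. \<forall>a\<ge>N. \<forall>b\<ge>N. dist (x a) (x b) < \<epsilon>" by blast
  qed
  then obtain xs where xs: "x \<longlonglongrightarrow> xs"
    using Cauchy_convergent convergent_def by blast
  have "infdist xs C = 0"
    using LIMSEQ_unique[OF tendsto_infdist[OF xs] d0] .
  then show ?thesis
    using xs cl nonempty in_closed_iff_infdist_zero by blast
qed

text \<open>If \<open>x 0\<close> is in \<open>C\<close>, the sequence is constant and any ratio will do. Otherwise the geometric decay of
the distance to \<open>C\<close> is combined with the strict bound of \<open>norm_diff_limit_less\<close>, which makes the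
constant \<open>2 * infdist (x 0) C\<close> possible.\<close>

lemma strongly_fejer_linear_convergence:
  fixes x :: "nat \<Rightarrow> 'a::{real_inner,complete_space}"
  assumes "strongly_fejer C x r" and cl: "closed C" and K: "0 < K" and L: "0 < L"
    and le: "\<And>k. infdist (x k) C \<le> K * strongly_fejer.path_length x k L"
  shows "\<exists>xs\<in>C. \<exists>q. 0 < q \<and> q < 1 \<and> (\<forall>k. norm (x k - xs) \<le> 2 * infdist (x 0) C * q ^ k)"
proof -
  interpret strongly_fejer C x r by fact
  obtain \<theta> where \<theta>: "0 < \<theta>" "\<theta> < 1" "\<And>k. infdist (x (k + L)) C \<le> \<theta> * infdist (x k) C"
    using infdist_contracts[OF K L le] by blast
  have dec: "decseq (\<lambda>k. infdist (x k) C)" by (simp add: decseq_def infdist_antimono)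
  obtain c q where q: "0 < q" "q < 1" and geo: "\<And>k. infdist (x k) C \<le> c * q ^ k"
    by (rule geometric_bound_from_blocks[of "\<lambda>k. infdist (x k) C", OF dec infdist_nonneg \<theta>(1,2) L \<theta>(3)])
      (rule that)
  have "(\<lambda>k. c * q ^ k) \<longlonglongrightarrow> c * 0"
    using q by (intro tendsto_intros LIMSEQ_power_zero) auto
  then have "(\<lambda>k. infdist (x k) C) \<longlonglongrightarrow> 0"
    using Lim_null_comparison[of "\<lambda>k. infdist (x k) C" "\<lambda>k. c * q ^ k" sequentially] geo
    by (simp add: infdist_nonneg)
  then obtain xs where xs: "xs \<in> C" "x \<longlonglongrightarrow> xs"
    using strongly_fejer_converges[OF assms(1) cl] by blast
  note bound = norm_diff_limit_le_infdist[OF xs(2)]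
  show ?thesis
  proof (cases "infdist (x 0) C = 0")
    case True
    then have "norm (x k - xs) \<le> 2 * infdist (x 0) C * (1/2) ^ k" for k
      using bound[of k] infdist_antimono[of 0 k] infdist_nonneg[of "x k" C] by simp
    then show ?thesis using xs(1) by (intro bexI[of _ xs] exI[of _ "1/2"]) auto
  next
    case False
    then have pos: "0 < infdist (x 0) C" using infdist_nonneg[of "x 0" C] by linarith
    have "x 0 \<noteq> xs" using False xs(1) by auto
    then have less: "norm (x k - xs) < 2 * infdist (x 0) C" for k
      by (rule norm_diff_limit_less[OF xs(2) _ pos])
    have geo': "norm (x k - xs) \<le> (2 * c) * q ^ k" for k
      using bound[of k] geo[of k] by simp
    have pos2: "0 < 2 * infdist (x 0) C" using pos by simp
    obtain q' where "0 < q'" "q' < 1" "\<And>k. norm (x k - xs) \<le> 2 * infdist (x 0) C * q' ^ k"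
      by (rule geometric_bound_with_constant[OF pos2 less q geo']) (rule that)
    then show ?thesis using xs(1) by blast
  qed
qed

section \<open>Visits with bounded gaps\<close>

text \<open>The first visit at or after time \<open>k\<close> is either visit number \<open>0\<close>, which can be as late as \<open>n 0\<close>, or it
follows a visit before \<open>k\<close> by at most \<open>s\<close>. The window has to cover both cases.\<close>

lemma bounded_gaps_hit_window:
  fixes n :: "nat \<Rightarrow> nat"
  assumes gaps: "\<And>k. n k < n (Suc k) \<and> n (Suc k) - n k \<le> s"
  shows "\<exists>j. k \<le> n j \<and> n j \<le> k + (n 0 + s)"
proof -
  have "strict_mono n" using gaps by (simp add: strict_mono_Suc_iff)
  then have ex: "k \<le> n k" by (rule seq_suble)
  define j where "j = (LEAST j. k \<le> n j)"
  have j: "k \<le> n j" unfolding j_def using ex by (rule LeastI)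
  have "n j \<le> k + (n 0 + s)"
  proof (cases j)
    case (Suc i)
    then have "n i < k" using not_less_Least[of i "\<lambda>j. k \<le> n j"] by (simp add: j_def)
    then show ?thesis using gaps[of i] Suc by auto
  qed simp
  with j show ?thesis by blast
qed

text \<open>Subsequences of the given times \<open>p\<close> and of the visits \<open>n\<close> that stay within \<open>w\<close> of each other. Thinning
\<open>p\<close> by the factor \<open>Suc w\<close> separates the windows, so that the visits chosen in them are distinct and
increasing.\<close>

lemma strict_mono_window_indices:
  fixes n p :: "nat \<Rightarrow> nat"
  assumes n: "strict_mono n" and p: "strict_mono p"
    and window: "\<And>k. \<exists>j. k \<le> n j \<and> n j \<le> k + w"
  obtains q j where "strict_mono (q :: nat \<Rightarrow> nat)" "strict_mono (j :: nat \<Rightarrow> nat)"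
    "\<And>k. p (q k) \<le> n (j k)" "\<And>k. n (j k) \<le> p (q k) + w"
proof -
  define q where "q k = k * Suc w" for k
  have "\<forall>k. \<exists>j. p (q k) \<le> n j \<and> n j \<le> p (q k) + w"
    by (intro allI window)
  from choice[OF this] obtain j where j: "\<And>k. p (q k) \<le> n (j k)" "\<And>k. n (j k) \<le> p (q k) + w"
    by auto
  have "strict_mono q" by (simp add: q_def strict_mono_Suc_iff)
  moreover have "strict_mono j"
    unfolding strict_mono_Suc_iff
  proof
    fix k
    have shift: "p a + b \<le> p (a + b)" for a b
    proof (induction b)
      case (Suc b)
      then show ?case using strict_monoD[OF p, of "a + b" "a + Suc b"] by simp
    qed simp
    have "q (Suc k) = q k + Suc w" by (simp add: q_def)
    then have "p (q k) + Suc w \<le> p (q (Suc k))"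
      using shift[of "q k" "Suc w"] by (simp only:)
    then have "n (j k) < n (j (Suc k))"
      using j(2)[of k] j(1)[of "Suc k"] by linarith
    then show "j k < j (Suc k)" using strict_mono_less[OF n] by blast
  qed
  ultimately show thesis using j by (rule that)
qed

section \<open>Iterations of regular operators\<close>

lemma (in strongly_fejer) norm_diff_tendsto_0_in_window:
  fixes a b :: "nat \<Rightarrow> nat"
  assumes "filterlim a at_top sequentially" "\<And>k. a k \<le> b k" "\<And>k. b k \<le> a k + L"
  shows "(\<lambda>k. norm (x (b k) - x (a k))) \<longlonglongrightarrow> 0"
proof (rule tendsto_sandwich[OF _ _ tendsto_const])
  show "(\<lambda>k. path_length (a k) L) \<longlonglongrightarrow> 0"
    by (rule filterlim_compose[OF path_length_tendsto_0 assms(1)])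
  show "\<forall>\<^sub>F k in sequentially. norm (x (b k) - x (a k)) \<le> path_length (a k) L"
    by (intro always_eventually allI norm_diff_le_path_length assms)
qed auto

locale strongly_fejer_iteration = strongly_fejer C x r
  for C :: "'a::real_inner set" and x r +
  fixes U :: "nat \<Rightarrow> 'a \<Rightarrow> 'a"
  assumes iterate: "\<And>k. x (Suc k) = U k (x k)"
begin

text \<open>The weak limit along \<open>p\<close> is also the weak limit along visits that are at most \<open>w\<close> steps later,
because the distance travelled in \<open>w\<close> steps tends to zero; regularity applies to these visits.\<close>

lemma weak_cluster_point_in_visited_set:
  assumes reg: "weakly_regular T (\<lambda>k. U (n k))" and n: "strict_mono n"
    and window: "\<And>k. \<exists>j. k \<le> n j \<and> n j \<le> k + w"
    and p: "strict_mono p" and y: "weakly_converges_to (x \<circ> p) y"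
  shows "y \<in> T"
proof -
  obtain q j where q: "strict_mono (q :: nat \<Rightarrow> nat)" and j: "strict_mono (j :: nat \<Rightarrow> nat)"
    and pq: "\<And>k. p (q k) \<le> n (j k)" "\<And>k. n (j k) \<le> p (q k) + w"
    using strict_mono_window_indices[OF n p window] by blast
  have "(\<lambda>k. norm (x (n (j k)) - x (p (q k)))) \<longlonglongrightarrow> 0"
    using filterlim_compose[OF filterlim_subseq[OF p] filterlim_subseq[OF q]] pq
    by (rule norm_diff_tendsto_0_in_window)
  moreover have "weakly_converges_to (\<lambda>k. x (p (q k))) y"
    using weakly_converges_to_subsequence[OF y q] by (simp add: o_def)
  ultimately have "weakly_converges_to (\<lambda>k. x (n (j k))) y"
    by (rule weakly_converges_to_norm_close[rotated])
  moreover have "(\<lambda>k. norm (U (n k) (x (n k)) - x (n k))) \<longlonglongrightarrow> 0"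
    using LIMSEQ_subseq_LIMSEQ[OF steps_tendsto_0 n] by (simp add: iterate o_def)
  ultimately show ?thesis
    using reg[unfolded weakly_regular_def, rule_format, OF j, of "\<lambda>k. x (n k)"] by blast
qed

lemma infdist_visited_set_tendsto_0:
  assumes reg: "boundedly_regular T (\<lambda>k. U (n k))" and n: "strict_mono n"
    and window: "\<And>k. \<exists>j. k \<le> n j \<and> n j \<le> k + w"
  shows "(\<lambda>k. infdist (x k) T) \<longlonglongrightarrow> 0"
proof -
  have "bounded (range (\<lambda>k. x (n k)))"
    using bounded_range by (rule bounded_subset) auto
  moreover have "(\<lambda>k. norm (U (n k) (x (n k)) - x (n k))) \<longlonglongrightarrow> 0"
    using LIMSEQ_subseq_LIMSEQ[OF steps_tendsto_0 n] by (simp add: iterate o_def)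
  ultimately have visits: "(\<lambda>k. infdist (x (n k)) T) \<longlonglongrightarrow> 0"
    using reg[unfolded boundedly_regular_def] by blast
  obtain j where j: "\<And>k. k \<le> n (j k)" "\<And>k. n (j k) \<le> k + w"
    using window by metis
  \<comment> \<open>The visit chosen after time \<open>k\<close> has a large number if \<open>k\<close> is large, as \<open>n\<close> is increasing.\<close>
  have "filterlim j at_top sequentially"
    unfolding filterlim_at_top eventually_sequentially
  proof
    fix J
    have "J \<le> j k" if "n J \<le> k" for k
      using that j(1)[of k] strict_mono_less_eq[OF n, of J "j k"] by linarith
    then show "\<exists>N. \<forall>k\<ge>N. J \<le> j k" by blast
  qed
  then have "(\<lambda>k. infdist (x (n (j k))) T) \<longlonglongrightarrow> 0"
    by (rule filterlim_compose[OF visits])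
  moreover have "(\<lambda>k. norm (x (n (j k)) - x k)) \<longlonglongrightarrow> 0"
    using filterlim_ident j by (rule norm_diff_tendsto_0_in_window)
  ultimately have lim: "(\<lambda>k. infdist (x (n (j k))) T + norm (x (n (j k)) - x k)) \<longlonglongrightarrow> 0"
    using tendsto_add_zero by blast
  show ?thesis
  proof (rule tendsto_sandwich[OF _ _ tendsto_const lim])
    show "\<forall>\<^sub>F k in sequentially. infdist (x k) T \<le> infdist (x (n (j k))) T + norm (x (n (j k)) - x k)"
      using infdist_triangle[of "x _" T "x (n (j _))"]
      by (intro always_eventually allI) (simp add: dist_norm norm_minus_commute)
  qed (simp add: infdist_nonneg)
qed

text \<open>Within \<open>w\<close> steps from \<open>x k\<close> there is a visit, where the distance to \<open>T\<close> is bounded by a multiple of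
the step taken there. The path of \<open>Suc w\<close> steps is long enough to contain this step as well as the
way to the visit.\<close>

lemma infdist_visited_set_le_path_length:
  assumes reg: "boundedly_linearly_regular T (\<lambda>k. U (n k))"
    and window: "\<And>k. \<exists>j. k \<le> n j \<and> n j \<le> k + w"
  shows "\<exists>\<delta>>0. \<forall>k. infdist (x k) T \<le> \<delta> * path_length k (Suc w)"
proof -
  obtain \<delta> where \<delta>: "\<delta> > 0" "\<And>z k. z \<in> range x \<Longrightarrow> infdist z T \<le> \<delta> * norm (U (n k) z - z)"
    using reg bounded_range unfolding boundedly_linearly_regular_def by (metis UNIV_not_empty image_is_empty)
  have "infdist (x k) T \<le> (\<delta> + 1) * path_length k (Suc w)" for k
  proof -
    obtain j where j: "k \<le> n j" "n j \<le> k + w" using window by blast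
    have "infdist (x k) T \<le> infdist (x (n j)) T + norm (x (n j) - x k)"
      using infdist_triangle[of "x k" T "x (n j)"] by (simp add: dist_norm norm_minus_commute)
    also have "infdist (x (n j)) T \<le> \<delta> * norm (x (Suc (n j)) - x (n j))"
      using \<delta>(2)[of "x (n j)" j] by (simp add: iterate)
    also have "\<dots> \<le> \<delta> * path_length k (Suc w)"
      using \<delta>(1) j by (intro mult_left_mono norm_step_le_path_length) auto
    also have "norm (x (n j) - x k) \<le> path_length k (Suc w)"
      using j by (intro norm_diff_le_path_length) auto
    finally show ?thesis by (simp add: algebra_simps)
  qed
  with \<delta>(1) show ?thesis by (intro exI[of _ "\<delta> + 1"]) simp
qed

end

section \<open>Regular families of sets\<close>

lemma infdist_Inter_le_path_length:
  assumes "strongly_fejer C x r" "finite I" "I \<noteq> {}"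
    and fam: "boundedly_linearly_regular_family I D" and C: "C = (\<Inter>i\<in>I. D i)"
    and each: "\<And>i. i \<in> I \<Longrightarrow>
      \<exists>\<delta>>0. \<forall>k. infdist (x k) (D i) \<le> \<delta> * strongly_fejer.path_length x k L"
  shows "\<exists>K>0. \<forall>k. infdist (x k) C \<le> K * strongly_fejer.path_length x k L"
proof -
  interpret strongly_fejer C x r by fact
  obtain \<delta> where \<delta>: "\<And>i. i \<in> I \<Longrightarrow> \<delta> i > 0"
      "\<And>i k. i \<in> I \<Longrightarrow> infdist (x k) (D i) \<le> \<delta> i * path_length k L"
    using each by metis
  obtain \<kappa> where \<kappa>: "\<kappa> > 0" "\<And>z. z \<in> range x \<Longrightarrow> infdist z C \<le> \<kappa> * (MAX i\<in>I. infdist z (D i))"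
    using fam bounded_range C unfolding boundedly_linearly_regular_family_def
    by (metis UNIV_not_empty image_is_empty)
  have "infdist (x k) C \<le> (\<kappa> * sum \<delta> I) * path_length k L" for k
  proof -
    have "infdist (x k) (D i) \<le> sum \<delta> I * path_length k L" if "i \<in> I" for i
    proof -
      have "\<delta> i \<le> sum \<delta> I"
        using \<delta>(1) assms(2) that by (intro member_le_sum) (auto intro: less_imp_le)
      then have "\<delta> i * path_length k L \<le> sum \<delta> I * path_length k L"
        by (intro mult_right_mono path_length_nonneg)
      with \<delta>(2)[OF that, of k] show ?thesis by linarith
    qed
    then have "(MAX i\<in>I. infdist (x k) (D i)) \<le> sum \<delta> I * path_length k L"
      using assms(2,3) by simp
    then have "\<kappa> * (MAX i\<in>I. infdist (x k) (D i)) \<le> \<kappa> * (sum \<delta> I * path_length k L)"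
      using \<kappa>(1) by (intro mult_left_mono) auto
    then show ?thesis
      using \<kappa>(2)[of "x k"] by (simp add: mult.assoc)
  qed
  moreover have "\<kappa> * sum \<delta> I > 0" using \<kappa>(1) \<delta>(1) assms(2,3) by (simp add: sum_pos)
  ultimately show ?thesis by blast
qed

lemma infdist_Inter_tendsto_0:
  fixes x :: "nat \<Rightarrow> 'a::real_inner"
  assumes I: "finite I" "I \<noteq> {}" and fam: "boundedly_regular_family I D"
    and bd: "bounded (range x)"
    and each: "\<And>i. i \<in> I \<Longrightarrow> (\<lambda>k. infdist (x k) (D i)) \<longlonglongrightarrow> 0"
  shows "(\<lambda>k. infdist (x k) (\<Inter>i\<in>I. D i)) \<longlonglongrightarrow> 0"
proof -
  have "(\<lambda>k. MAX i\<in>I. infdist (x k) (D i)) \<longlonglongrightarrow> 0"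
  proof (rule tendsto_sandwich[OF _ _ tendsto_const])
    show "(\<lambda>k. \<Sum>i\<in>I. infdist (x k) (D i)) \<longlonglongrightarrow> 0"
      using tendsto_sum[OF each] by simp
    show "\<forall>\<^sub>F k in sequentially. (MAX i\<in>I. infdist (x k) (D i)) \<le> (\<Sum>i\<in>I. infdist (x k) (D i))"
      using I by (intro always_eventually allI) (auto intro!: member_le_sum simp: infdist_nonneg)
    show "\<forall>\<^sub>F k in sequentially. 0 \<le> (MAX i\<in>I. infdist (x k) (D i))"
      using I by (intro always_eventually allI) (auto simp: Max_ge_iff infdist_nonneg)
  qed
  with fam bd show ?thesis unfolding boundedly_regular_family_def by blast
qed

section \<open>Convergence of the iteration\<close>

theorem theorem6p2:
  fixes C :: "nat \<Rightarrow> 'a::{real_inner, complete_space} set"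
    and U :: "nat \<Rightarrow> 'a \<Rightarrow> 'a"
    and \<rho> :: "nat \<Rightarrow> real"
    and x :: "nat \<Rightarrow> 'a"
    and n :: "nat \<Rightarrow> nat \<Rightarrow> nat"
    and m s :: nat
  assumes "1 \<le> m"
    and "\<And>i. i \<in> {1..m} \<Longrightarrow> closed (C i) \<and> convex (C i)"
    and "(\<Inter>i\<in>{1..m}. C i) \<noteq> {}"
    and "\<And>k. strongly_quasi_nonexpansive (\<rho> k) (U k)"
    and "(\<Inter>i\<in>{1..m}. C i) \<subseteq> (\<Inter>k. Fix (U k))"
    and "0 < (INF k. \<rho> k)"
    and "\<And>k. x (Suc k) = U k (x k)"
    and "0 < s"
    and "\<And>i k. i \<in> {1..m} \<Longrightarrow> n i k < n i (Suc k) \<and> n i (Suc k) - n i k \<le> s"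
  shows
    "((\<forall>i\<in>{1..m}. weakly_regular (C i) (\<lambda>k. U (n i k))) \<longrightarrow>
        (\<exists>xs \<in> (\<Inter>i\<in>{1..m}. C i). weakly_converges_to x xs))
     \<and> ((\<forall>i\<in>{1..m}. boundedly_regular (C i) (\<lambda>k. U (n i k))) \<and>
          boundedly_regular_family {1..m} C \<longrightarrow>
        (\<exists>xs \<in> (\<Inter>i\<in>{1..m}. C i). x \<longlonglongrightarrow> xs))
     \<and> ((\<forall>i\<in>{1..m}. boundedly_linearly_regular (C i) (\<lambda>k. U (n i k))) \<and>
          boundedly_linearly_regular_family {1..m} C \<longrightarrow>
        (\<exists>xs \<in> (\<Inter>i\<in>{1..m}. C i). \<exists>q. 0 < q \<and> q < 1 \<and>
           (\<forall>k. norm (x k - xs) \<le> 2 * infdist (x 0) (\<Inter>i\<in>{1..m}. C i) * q ^ k)))"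
proof -
  define D where "D = (\<Inter>i\<in>{1..m}. C i)"
  define r where "r = (INF k. \<rho> k)"
  have ne: "{1..m} \<noteq> {}" using assms(1) by simp
  have cl: "closed D" using assms(2) by (auto simp: D_def)
  have fejer: "strongly_fejer D x r"
  proof
    show "D \<noteq> {}" "0 < r" using assms(3,6) by (auto simp: D_def r_def)
    fix k z assume "z \<in> D"
    then have z: "z \<in> Fix (U k)" using assms(5) by (auto simp: D_def)
    have "bdd_below (range \<rho>)"
      using assms(4) by (auto simp: strongly_quasi_nonexpansive_def intro!: bdd_belowI[of _ 0])
    then have "r \<le> \<rho> k" unfolding r_def by (rule cINF_lower) simp
    then have "r * (norm (x (Suc k) - x k))\<^sup>2 \<le> \<rho> k * (norm (x (Suc k) - x k))\<^sup>2"
      by (rule mult_right_mono) simp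
    moreover have "(norm (x (Suc k) - z))\<^sup>2 \<le> (norm (x k - z))\<^sup>2 - \<rho> k * (norm (x (Suc k) - x k))\<^sup>2"
      using assms(4)[of k] z by (simp add: strongly_quasi_nonexpansive_def assms(7))
    ultimately show "(norm (x (Suc k) - z))\<^sup>2 \<le> (norm (x k - z))\<^sup>2 - r * (norm (x (Suc k) - x k))\<^sup>2"
      by linarith
  qed
  interpret strongly_fejer_iteration D x r U
    by (rule strongly_fejer_iteration.intro[OF fejer]) (unfold_locales, rule assms(7))
  have n: "strict_mono (n i)" if "i \<in> {1..m}" for i
    using assms(9)[OF that] by (simp add: strict_mono_Suc_iff)
  \<comment> \<open>The sum bounds every first visit \<open>n i 0\<close>, so that one window length serves all \<open>i\<close>.\<close>
  define w where "w = (\<Sum>i\<in>{1..m}. n i 0) + s"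
  have window: "\<exists>j. k \<le> n i j \<and> n i j \<le> k + w" if i: "i \<in> {1..m}" for i k
  proof -
    have "n i 0 \<le> (\<Sum>i\<in>{1..m}. n i 0)" using i by (intro member_le_sum) auto
    moreover obtain j where "k \<le> n i j" "n i j \<le> k + (n i 0 + s)"
      using bounded_gaps_hit_window[of "n i" s k, OF assms(9)[OF i]] by blast
    ultimately show ?thesis unfolding w_def by (intro exI[of _ j]) linarith
  qed
  have weak: "\<exists>xs\<in>D. weakly_converges_to x xs"
    if reg: "\<forall>i\<in>{1..m}. weakly_regular (C i) (\<lambda>k. U (n i k))"
  proof (rule strongly_fejer_weakly_converges[OF fejer])
    fix p y assume p: "strict_mono (p :: nat \<Rightarrow> nat)" and y: "weakly_converges_to (x \<circ> p) y"
    have "y \<in> C i" if i: "i \<in> {1..m}" for i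
      by (rule weak_cluster_point_in_visited_set[OF bspec[OF reg i] n[OF i] window[OF i] p y])
    then show "y \<in> D" by (simp add: D_def)
  qed
  have strong: "\<exists>xs\<in>D. x \<longlonglongrightarrow> xs"
    if "\<forall>i\<in>{1..m}. boundedly_regular (C i) (\<lambda>k. U (n i k))" "boundedly_regular_family {1..m} C"
  proof (rule strongly_fejer_converges[OF fejer cl])
    show "(\<lambda>k. infdist (x k) D) \<longlonglongrightarrow> 0"
      unfolding D_def
    proof (rule infdist_Inter_tendsto_0[OF finite_atLeastAtMost ne that(2) bounded_range])
      fix i assume i: "i \<in> {1..m}"
      show "(\<lambda>k. infdist (x k) (C i)) \<longlonglongrightarrow> 0"
        by (rule infdist_visited_set_tendsto_0[OF bspec[OF that(1) i] n[OF i] window[OF i]])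
    qed
  qed
  have linear: "\<exists>xs\<in>D. \<exists>q. 0 < q \<and> q < 1 \<and> (\<forall>k. norm (x k - xs) \<le> 2 * infdist (x 0) D * q ^ k)"
    if "\<forall>i\<in>{1..m}. boundedly_linearly_regular (C i) (\<lambda>k. U (n i k))"
      "boundedly_linearly_regular_family {1..m} C"
  proof -
    have "\<exists>K>0. \<forall>k. infdist (x k) D \<le> K * path_length k (Suc w)"
    proof (rule infdist_Inter_le_path_length[OF fejer finite_atLeastAtMost ne that(2) D_def])
      fix i assume i: "i \<in> {1..m}"
      show "\<exists>\<delta>>0. \<forall>k. infdist (x k) (C i) \<le> \<delta> * path_length k (Suc w)"
        by (rule infdist_visited_set_le_path_length[OF bspec[OF that(1) i] window[OF i]])
    qed
    then obtain K where K: "K > 0" "\<And>k. infdist (x k) D \<le> K * path_length k (Suc w)" by blast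
    show ?thesis
      by (rule strongly_fejer_linear_convergence[OF fejer cl K(1) zero_less_Suc K(2)])
  qed
  show ?thesis
    unfolding D_def[symmetric]
    by (intro conjI impI; (elim conjE)?; rule weak strong linear; assumption)
qed

end
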